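(* Let $D$ be a principal ideal domain with quotient field $K$, and let $f\in\operatorname{Int}(D)=\{f\in K[x]\mid f(D)\subseteq D\}$ be non-constant and image-primitive, with square-free denominator, written in standard form as $$f=\frac{\prod_{i\in I}g_i}{\prod_{p\in T}p},$$ where $I\neq\emptyset$ is a finite set, for each $i\in I$ the polynomial $g_i\in D[x]$ is primitive and irreducible in $D[x]$, and $T$ is a finite set of pairwise non-associated primes of $D$. Let $G$ be the quintessential graph of $(g_i\mid i\in I)$. Then $f$ is absolutely irreducible in $\operatorname{Int}(D)$ if and only if $G$ is connected.
   Context: A polynomial in $D[x]$ is primitive if the greatest common divisor of its coefficients is $1$. Standard form: a non-zero $f\in K[x]$ is written as $f=\frac{a\prod_{i\in I}g_i}{b}$ with $a,b\in D\setminus\{0\}$, $\gcd(a,b)=1$, $I$ a finite set, and each $g_i$ primitive and irreducible in $D[x]$ (the $g_i$ need not be distinct for distinct indices); $b$ is called the denominator; $a$, $b$ and the numerator are unique only up to units of $D$, and for image-primitive $f$ one may take $a=1$. Fixed divisor: for $f\in\operatorname{Int}(D)$, $\mathsf d(f)$ is the ideal of $D$ generated by $f(D)$ (also identified with a generator of this ideal). $f\in\operatorname{Int}(D)$ is image-primitive if $\mathsf d(f)=D$. Quintessential: let $I\neq\emptyset$ be finite, $g_i\in D[x]$ ($i\in I$) non-constant and primitive, $g=\prod_{i\in I}g_i$, and $p\in D$ a prime element. $g_i$ is quintessential for $p$ among the $g_j$ with $j\in I$ if $p\mid\mathsf d(g)$ and there exists $w\in D$ such that $v_p(g_i(w))=v_p(\mathsf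 d(g))$ and $v_p(g_j(w))=0$ for all $j\in I\setminus\{i\}$, where $v_p$ is the $p$-adic valuation. Quintessential graph: for $g_i\in D[x]$ ($i\in I$) primitive and irreducible, the quintessential graph of $(g_i\mid i\in I)$ is the simple undirected graph with vertex set $I$ in which two (distinct) vertices $i,j$ are joined by an edge if and only if there is a prime element $p\in D$ such that both $g_i$ and $g_j$ are quintessential for $p$ among the $g_k$ with $k\in I$. Absolutely irreducible: in a commutative ring $R$ with identity, an element is irreducible if it is a non-zero non-unit that is not a product of two non-units; $r,s\in R$ are associated if $r=us$ for a unit $u$; two factorizations into irreducibles $a_1\cdots a_n=b_1\cdots b_m$ of the same element are essentially the same if $n=m$ and, after re-indexing, $a_j$ is associated to $b_j$ for all $j$. An irreducible $c\in R$ is absolutely irreducible if for all natural numbers $n$ every factorization of $c^n$ into irreducibles is essentially the same as $c^n=c\cdots c$. *)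

theory Defs
  imports
    "HOL-Library.Extended_Nat"
    "HOL-Library.Multiset"
    "HOL-Computational_Algebra.Polynomial_Factorial"
    "Graph_Theory.Digraph_Component"
begin

section \<open>Principal ideal domains\<close>

text \<open>Ideals are the submodules of the ring, regarded as a module over itself.\<close>

abbreviation is_ideal :: "'a::comm_ring_1 set \<Rightarrow> bool"
  where "is_ideal \<equiv> module.subspace (*)"

abbreviation ideal_generated_by :: "'a::comm_ring_1 set \<Rightarrow> 'a set"
  where "ideal_generated_by \<equiv> module.span (*)"

lemma module_mult: "module ((*) :: 'a::comm_ring_1 \<Rightarrow> 'a \<Rightarrow> 'a)"
  by unfold_locales (simp_all add: algebra_simps)

definition principal_ideal_domain :: "'a::idom itself \<Rightarrow> bool"
  where "principal_ideal_domain _ \<longleftrightarrow> (\<forall>A :: 'a set. is_ideal A \<longrightarrow> (\<exists>d. A = ideal_generated_by {d}))"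


section \<open>Associated elements and absolute irreducibility\<close>

definition associated :: "'a::comm_ring_1 \<Rightarrow> 'a \<Rightarrow> bool"
  where "associated r s \<longleftrightarrow> (\<exists>u. u dvd 1 \<and> r = u * s)"

text \<open>A factorization is the multiset of its factors; \<^const>\<open>rel_mset\<close> matches the factors of two
  factorizations bijectively, which encodes both the equal length and the re-indexing.\<close>

definition irreducible_factorization :: "'a::comm_ring_1 multiset \<Rightarrow> 'a \<Rightarrow> bool"
  where "irreducible_factorization A x \<longleftrightarrow> (\<forall>a\<in>#A. irreducible a) \<and> prod_mset A = x"

definition essentially_same :: "'a::comm_ring_1 multiset \<Rightarrow> 'a multiset \<Rightarrow> bool"
  where "essentially_same = rel_mset associated"

definition absolutely_irreducible :: "'a::comm_ring_1 \<Rightarrow> bool"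
  where "absolutely_irreducible c \<longleftrightarrow>
    irreducible c \<and>
    (\<forall>n A. irreducible_factorization A (c ^ n) \<longrightarrow> essentially_same A (replicate_mset n c))"


section \<open>The ring of integer-valued polynomials\<close>

typedef (overloaded) 'a int_valued_poly =
  "{f :: 'a::idom fract poly. \<forall>a. poly f (to_fract a) \<in> range to_fract}"
  morphisms poly_of_int_valued Int_valued
  by (rule exI[of _ 0]) (auto intro: range_eqI[of _ _ 0])

setup_lifting type_definition_int_valued_poly

instantiation int_valued_poly :: (idom) idom
begin

lift_definition zero_int_valued_poly :: "'a int_valued_poly" is 0
  by (auto intro: range_eqI[of _ _ 0])

lift_definition one_int_valued_poly :: "'a int_valued_poly" is 1
  by (auto intro: range_eqI[of _ _ 1])

lift_definition plus_int_valued_poly ::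
  "'a int_valued_poly \<Rightarrow> 'a int_valued_poly \<Rightarrow> 'a int_valued_poly" is "(+)"
  by (simp add: image_iff) (metis to_fract_add)

lift_definition minus_int_valued_poly ::
  "'a int_valued_poly \<Rightarrow> 'a int_valued_poly \<Rightarrow> 'a int_valued_poly" is "(-)"
  by (simp add: image_iff) (metis to_fract_diff)

lift_definition uminus_int_valued_poly ::
  "'a int_valued_poly \<Rightarrow> 'a int_valued_poly" is uminus
  by (simp add: image_iff) (metis to_fract_uminus)

lift_definition times_int_valued_poly ::
  "'a int_valued_poly \<Rightarrow> 'a int_valued_poly \<Rightarrow> 'a int_valued_poly" is "(*)"
  by (simp add: image_iff) (metis to_fract_mult)

instance
  by standard (transfer; simp add: algebra_simps)+

end


section \<open>Fixed divisors and valuations\<close>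

text \<open>Only meaningful for integer-valued arguments; \<^const>\<open>poly_of_int_valued\<close> and
  \<^const>\<open>fract_poly\<close> embed the integer-valued polynomials and \<open>D[x]\<close>, respectively.\<close>

definition fixed_divisor :: "'a::idom fract poly \<Rightarrow> 'a set"
  where "fixed_divisor f = ideal_generated_by {b. \<exists>a. poly f (to_fract a) = to_fract b}"

definition image_primitive :: "'a::idom int_valued_poly \<Rightarrow> bool"
  where "image_primitive f \<longleftrightarrow> fixed_divisor (poly_of_int_valued f) = UNIV"

text \<open>Unlike the library's \<open>multiplicity\<close>, this takes the value \<open>\<infinity>\<close> at \<open>0\<close>.\<close>

definition valuation :: "'a::idom \<Rightarrow> 'a \<Rightarrow> enat"
  where "valuation p x = Sup {enat n | n. p ^ n dvd x}"


section \<open>Quintessential polynomials and their graph\<close>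

text \<open>The greatest common divisor of the coefficients is \<open>1\<close>, i.e. all their common divisors are units.\<close>

definition primitive :: "'a::idom poly \<Rightarrow> bool"
  where "primitive g \<longleftrightarrow> (\<forall>d. (\<forall>n. d dvd coeff g n) \<longrightarrow> d dvd 1)"

text \<open>Here \<open>d\<close> is a generator of the fixed divisor of the product; nothing depends on its choice.\<close>

definition quintessential :: "('i \<Rightarrow> 'a::idom poly) \<Rightarrow> 'i set \<Rightarrow> 'a \<Rightarrow> 'i \<Rightarrow> bool"
  where "quintessential g I p i \<longleftrightarrow>
    (\<exists>d. fixed_divisor (fract_poly (\<Prod>k\<in>I. g k)) = ideal_generated_by {d} \<and>
         p dvd d \<and>
         (\<exists>w. valuation p (poly (g i) w) = valuation p d \<and>
              (\<forall>j\<in>I - {i}. valuation p (poly (g j) w) = 0)))"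

text \<open>An undirected edge is represented by its two opposite arcs.\<close>

definition quintessential_graph :: "('i \<Rightarrow> 'a::idom poly) \<Rightarrow> 'i set \<Rightarrow> 'i pair_pre_digraph"
  where "quintessential_graph g I =
    \<lparr> pverts = I,
      parcs = {(i, j). i \<in> I \<and> j \<in> I \<and> i \<noteq> j \<and>
        (\<exists>p. prime_elem p \<and> quintessential g I p i \<and> quintessential g I p j)} \<rparr>"

lemma pair_graph_quintessential_graph:
  assumes "finite I"
  shows "pair_graph (quintessential_graph g I)"
proof
  show "finite (parcs (quintessential_graph g I))"
    by (rule finite_subset[of _ "I \<times> I"]) (auto simp: quintessential_graph_def assms)
  show "symmetric (with_proj (quintessential_graph g I))"
    by (auto simp: quintessential_graph_def symmetric_def intro!: symI)
qed (auto simp: quintessential_graph_def assms)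

end

theory Submission
  imports Defs
begin

text \<open>If \<open>F\<close> divides \<open>f\<^sup>n\<close> in \<open>Int(D)\<close>, then \<open>F = c \<Prod>\<^bsub>i\<^esub> (g i) ^ (a i)\<close> with \<open>c \<in> K\<close>, as the \<open>g i\<close>
  are prime in \<open>K[x]\<close> by Gauss's lemma. If \<open>w\<close> witnesses that \<open>g i\<close> is quintessential for \<open>p\<close>,
  then \<open>p\<close> does not divide \<open>f(w)\<close>, hence not \<open>F(w)\<close>, so \<open>a i\<close> is the \<open>p\<close>-adic valuation of \<open>1/c\<close>
  and does not depend on \<open>i\<close>. Thus \<open>a\<close> is constant if the graph is connected, and then \<open>F\<close> is a unit
  times a power of \<open>f\<close> because \<open>f\<close> is image-primitive.

  Conversely, let \<open>I\<close> be the disjoint union of non-empty \<open>X\<close> and \<open>Y\<close> without edges between them. Then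
  \<open>T\<close> is the disjoint union of \<open>U\<close> and \<open>V\<close> such that no index in \<open>Y\<close> is quintessential for a prime in
  \<open>U\<close>, and none in \<open>X\<close> for a prime in \<open>V\<close>. For \<open>p \<in> V\<close> and every \<open>w\<close>, either \<open>p\<close> divides
  \<open>\<Prod>\<^bsub>Y\<^esub> g(w)\<close> or \<open>p\<^sup>2\<close> divides \<open>\<Prod>\<^bsub>I\<^esub> g(w)\<close>, so \<open>f \<Prod>\<^bsub>Y\<^esub> g / \<Prod>V\<close> is integer-valued, and likewise
  \<open>f \<Prod>\<^bsub>X\<^esub> g / \<Prod>U\<close>. The product of these two is \<open>f\<^sup>3\<close>, but their degrees lie strictly between those
  of \<open>f\<close> and \<open>f\<^sup>2\<close>.\<close>


section \<open>Divisibility in principal ideal domains\<close>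

lemma mem_ideal_generated_by_singleton:
  "x \<in> ideal_generated_by {d} \<longleftrightarrow> d dvd x"
  unfolding module.span_singleton[OF module_mult] by (auto simp: dvd_def mult.commute)

lemma is_ideal_dvd_mult: "is_ideal {x. s dvd r * x}"
  by (rule module.subspaceI[OF module_mult]) (auto simp: distrib_left mult.left_commute)

text \<open>The \<open>x\<close> with \<open>s dvd r * x\<close> form an ideal. The factor
  \<open>r\<close> makes this the Bezout step of Euclid's lemma: if a unit lies in the ideal, then
  \<open>s\<close> divides \<open>r\<close> itself.\<close>

lemma dvd_mult_of_mem_ideal_generated_by:
  assumes "y \<in> ideal_generated_by S" and "\<And>x. x \<in> S \<Longrightarrow> s dvd r * x"
  shows "s dvd r * y"
proof -
  have "ideal_generated_by S \<subseteq> {x. s dvd r * x}"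
    by (rule module.span_minimal[OF module_mult]) (use assms(2) is_ideal_dvd_mult in auto)
  with assms(1) show ?thesis by auto
qed

lemma dvd_of_mem_ideal_generated_by:
  assumes "y \<in> ideal_generated_by S" and "\<And>x. x \<in> S \<Longrightarrow> d dvd x"
  shows "d dvd y"
  using dvd_mult_of_mem_ideal_generated_by[of y S d 1] assms by auto

text \<open>A generator of the ideal spanned by \<open>S\<close> serves as greatest common divisor;
  its membership in the ideal is Bezout's identity.\<close>

lemma principal_ideal_domain_gcd:
  fixes S :: "'a::idom set"
  assumes "principal_ideal_domain TYPE('a)"
  obtains d where "d \<in> ideal_generated_by S" and "\<And>x. x \<in> S \<Longrightarrow> d dvd x"
proof -
  have "is_ideal (ideal_generated_by S)"
    by (rule module.subspace_span[OF module_mult])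
  then obtain d where d: "ideal_generated_by S = ideal_generated_by {d}"
    using assms unfolding principal_ideal_domain_def by blast
  have "d dvd x" if "x \<in> S" for x
    using module.span_base[OF module_mult that] unfolding d mem_ideal_generated_by_singleton .
  moreover have "d \<in> ideal_generated_by S"
    unfolding d mem_ideal_generated_by_singleton by simp
  ultimately show thesis using that by blast
qed

text \<open>Along an infinite chain of proper divisors the principal ideals would increase, but a
  generator of their union already lies in one of them.\<close>

lemma principal_ideal_domain_wf:
  assumes "principal_ideal_domain TYPE('a::idom)"
  shows "wf {(x :: 'a, y). x dvd y \<and> \<not> y dvd x}"
  unfolding wf_iff_no_infinite_down_chain
proof clarify
  fix f :: "nat \<Rightarrow> 'a"
  assume "\<forall>n. (f (Suc n), f n) \<in> {(x, y). x dvd y \<and> \<not> y dvd x}"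
  then have step: "f (Suc n) dvd f n" "\<not> f n dvd f (Suc n)" for n
    by auto
  have mono: "f n dvd f m" if "m \<le> n" for m n
    using that by (induction rule: dec_induct) (auto intro: dvd_trans step)
  have "is_ideal {x. \<exists>n. f n dvd x}"
  proof (rule module.subspaceI[OF module_mult])
    fix x y assume "x \<in> {x. \<exists>n. f n dvd x}" "y \<in> {x. \<exists>n. f n dvd x}"
    then obtain m n where "f m dvd x" "f n dvd y" by auto
    \<comment> \<open>Later terms of the chain divide earlier ones, so the later of the two terms
      divides both elements.\<close>
    then have "f (max m n) dvd x" "f (max m n) dvd y"
      by (meson mono dvd_trans max.cobounded1 max.cobounded2)+
    then show "x + y \<in> {x. \<exists>n. f n dvd x}" by (auto intro: dvd_add)
  qed (auto intro: dvd_mult)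
  then obtain d where d: "{x. \<exists>n. f n dvd x} = ideal_generated_by {d}"
    using assms unfolding principal_ideal_domain_def by blast
  then have *: "(\<exists>n. f n dvd x) \<longleftrightarrow> d dvd x" for x
    using mem_ideal_generated_by_singleton[of x d] by auto
  then obtain n where "f n dvd d" by (metis dvd_refl)
  moreover have "d dvd f (Suc n)" using * by (metis dvd_refl)
  ultimately show False using step(2)[of n] dvd_trans by blast
qed

text \<open>A common divisor \<open>d\<close> of \<open>p\<close> and \<open>a\<close> with a Bezout
  identity is either associated to \<open>p\<close>, and then \<open>p\<close> divides
  \<open>a\<close>, or a unit, and then \<open>p\<close> divides \<open>b\<close>.\<close>

lemma principal_ideal_domain_irreducible_imp_prime_elem:
  fixes p :: "'a::idom"
  assumes "principal_ideal_domain TYPE('a)" and "irreducible p"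
  shows "prime_elem p"
proof (rule prime_elemI)
  fix a b assume ab: "p dvd a * b"
  obtain d where d: "d \<in> ideal_generated_by {p, a}" "d dvd p" "d dvd a"
    by (rule principal_ideal_domain_gcd[OF assms(1), of "{p, a}"]) auto
  then obtain e where e: "p = d * e" by auto
  have "d dvd 1 \<or> e dvd 1" using e assms(2) irreducibleD by blast
  then show "p dvd a \<or> p dvd b"
  proof
    assume "e dvd 1"
    then have "p dvd d" unfolding e by (metis dvd_refl mult.right_neutral mult_dvd_mono)
    then show ?thesis using d dvd_trans by blast
  next
    assume "d dvd 1"
    have "p dvd b * d"
      by (rule dvd_mult_of_mem_ideal_generated_by[OF d(1)]) (use ab in \<open>auto simp: mult.commute\<close>)
    moreover have "b * d dvd b" using \<open>d dvd 1\<close> by (metis dvd_refl mult.right_neutral mult_dvd_mono)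
    ultimately show ?thesis using dvd_trans by blast
  qed
next
  show "p \<noteq> 0" "\<not> p dvd 1" using assms(2) unfolding irreducible_def by blast+
qed

text \<open>Well-founded induction along proper divisibility: a reducible \<open>x\<close> has a
  proper divisor that is not a unit.\<close>

lemma principal_ideal_domain_prime_divisor:
  fixes x :: "'a::idom"
  assumes pid: "principal_ideal_domain TYPE('a)" and "x \<noteq> 0" and "\<not> x dvd 1"
  shows "\<exists>p. prime_elem p \<and> p dvd x"
proof -
  define R where "R = {(x :: 'a, y). x dvd y \<and> \<not> y dvd x}"
  have "wf R" unfolding R_def by (rule principal_ideal_domain_wf[OF pid])
  then show ?thesis using assms(2,3)
  proof (induction x rule: wf_induct_rule)
    case (less x)
    show ?case
    proof (cases "irreducible x")
      case True
      then have "prime_elem x"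
        by (rule principal_ideal_domain_irreducible_imp_prime_elem[OF pid])
      then show ?thesis using dvd_refl by blast
    next
      case False
      then obtain a b where ab: "x = a * b" "\<not> a dvd 1" "\<not> b dvd 1"
        using less.prems unfolding irreducible_def by blast
      have "a \<noteq> 0" using less.prems(1) ab(1) by auto
      have "\<not> x dvd a"
      proof
        assume "x dvd a"
        then obtain k where "a = a * b * k" unfolding ab(1) by (rule dvdE)
        then have "a * (b * k) = a * 1" by (simp add: mult.assoc)
        then have "b * k = 1" using \<open>a \<noteq> 0\<close> mult_left_cancel by blast
        then show False using ab(3) dvd_triv_left[of b k] by simp
      qed
      moreover have "a dvd x" unfolding ab(1) by (rule dvd_triv_left)
      ultimately have "(a, x) \<in> R" unfolding R_def by simp
      then obtain p where "prime_elem p" "p dvd a"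
        using less.IH[of a] \<open>a \<noteq> 0\<close> ab(2) by blast
      then show ?thesis using \<open>a dvd x\<close> dvd_trans by blast
    qed
  qed
qed

text \<open>The gcd of \<open>S\<close> is non-zero because of \<open>s\<close>, and it is no unit
  because \<open>1\<close> is not in the ideal, so some prime divides it.\<close>

lemma principal_ideal_domain_prime_dvd_generators:
  fixes S :: "'a::idom set"
  assumes "principal_ideal_domain TYPE('a)" and "1 \<notin> ideal_generated_by S"
    and "s \<in> S" and "s \<noteq> 0"
  obtains p where "prime_elem p" and "\<And>x. x \<in> S \<Longrightarrow> p dvd x"
proof -
  obtain d where d: "d \<in> ideal_generated_by S" "\<And>x. x \<in> S \<Longrightarrow> d dvd x"
    by (rule principal_ideal_domain_gcd[OF assms(1), of S]) auto
  have "d \<noteq> 0" using d(2) assms(3,4) by fastforce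
  moreover have "\<not> d dvd 1"
  proof
    assume "d dvd 1"
    then obtain e where "e * d = 1" by (auto simp: dvd_def mult.commute)
    with module.span_scale[OF module_mult d(1), of e] assms(2) show False by simp
  qed
  ultimately obtain p where "prime_elem p" "p dvd d"
    using principal_ideal_domain_prime_divisor[OF assms(1)] by blast
  then show thesis using that d(2) dvd_trans by blast
qed


section \<open>Gauss's lemma\<close>

text \<open>The gcd of the coefficients is a unit and lies in the ideal that they generate.\<close>

lemma primitive_dvd_of_dvd_mult_coeff:
  fixes g :: "'a::idom poly"
  assumes "principal_ideal_domain TYPE('a)" and "primitive g" and "\<And>n. s dvd r * coeff g n"
  shows "s dvd r"
proof -
  obtain d where d: "d \<in> ideal_generated_by (range (coeff g))" "\<And>x. x \<in> range (coeff g) \<Longrightarrow> d dvd x"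
    by (rule principal_ideal_domain_gcd[OF assms(1), of "range (coeff g)"]) auto
  have "d dvd 1" using assms(2) d(2) unfolding primitive_def by blast
  moreover have "s dvd r * d"
    by (rule dvd_mult_of_mem_ideal_generated_by[OF d(1)]) (use assms(3) in auto)
  ultimately show ?thesis by (metis dvd_refl dvd_trans mult.right_neutral mult_dvd_mono)
qed

lemma primitive_imp_nonzero: "primitive g \<Longrightarrow> g \<noteq> 0"
  unfolding primitive_def by (metis coeff_0 dvd_refl zero_neq_one dvd_0_left_iff)

text \<open>Otherwise some prime \<open>p\<close> divides all coefficients of the product; since
  \<open>p\<close> stays prime in \<open>D[x]\<close>, it divides all coefficients of one
  factor.\<close>

lemma primitive_mult:
  fixes a b :: "'a::idom poly"
  assumes "principal_ideal_domain TYPE('a)" and "primitive a" and "primitive b"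
  shows "primitive (a * b)"
  unfolding primitive_def
proof (intro allI impI)
  fix d assume d: "\<forall>n. d dvd coeff (a * b) n"
  show "d dvd 1"
  proof (rule ccontr)
    assume "\<not> d dvd 1"
    moreover have "d \<noteq> 0"
      using d primitive_imp_nonzero[OF assms(2)] primitive_imp_nonzero[OF assms(3)]
      by (metis dvd_0_left_iff leading_coeff_0_iff mult_eq_0_iff)
    ultimately obtain p where p: "prime_elem p" "p dvd d"
      using principal_ideal_domain_prime_divisor[OF assms(1)] by blast
    have "[:p:] dvd a * b"
      unfolding const_poly_dvd_iff using d p(2) dvd_trans by blast
    then have "[:p:] dvd a \<or> [:p:] dvd b"
      using lift_prime_elem_poly[OF p(1)] prime_elem_dvd_multD by blast
    then have "p dvd 1"
      unfolding const_poly_dvd_iff using assms(2,3) unfolding primitive_def by blast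
    then show False using p(1) prime_elem_not_unit by blast
  qed
qed

lemma primitive_part_exists:
  fixes g :: "'a::idom poly"
  assumes "principal_ideal_domain TYPE('a)" and "g \<noteq> 0"
  obtains c h where "c \<noteq> 0" and "primitive h" and "g = smult c h"
proof -
  obtain c where c: "c \<in> ideal_generated_by (range (coeff g))" "\<And>x. x \<in> range (coeff g) \<Longrightarrow> c dvd x"
    by (rule principal_ideal_domain_gcd[OF assms(1), of "range (coeff g)"]) auto
  have "[:c:] dvd g" unfolding const_poly_dvd_iff using c(2) by blast
  then obtain h where "g = [:c:] * h" by (rule dvdE)
  then have h: "g = smult c h" by simp
  then have "c \<noteq> 0" using assms(2) by auto
  moreover have "primitive h"
    unfolding primitive_def
  proof (intro allI impI)
    fix e assume e: "\<forall>n. e dvd coeff h n"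
    \<comment> \<open>Every coefficient of \<open>g\<close> is a multiple of \<open>c * e\<close>,
      and \<open>c\<close> is a linear combination of these coefficients.\<close>
    have "c * e dvd c"
      by (rule dvd_of_mem_ideal_generated_by[OF c(1)]) (use e h in \<open>auto intro: mult_dvd_mono\<close>)
    then have "c * e dvd c * 1" by simp
    then show "e dvd 1" using \<open>c \<noteq> 0\<close> by (simp only: dvd_mult_cancel_left) simp
  qed
  ultimately show thesis using h that by blast
qed

lemma degree_fract_poly [simp]: "degree (fract_poly p) = degree p"
  by (rule degree_map_poly) simp

lemma poly_fract_poly [simp]: "poly (fract_poly p) (to_fract x) = to_fract (poly p x)"
  by (induction p) (simp_all add: map_poly_pCons)

lemma fract_poly_prod: "fract_poly (\<Prod>i\<in>I. g i) = (\<Prod>i\<in>I. fract_poly (g i))"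
  by (induction I rule: infinite_finite_induct) simp_all

lemma fract_cases_to_fract:
  obtains r s where "s \<noteq> 0" and "x = to_fract r / to_fract s"
  by (cases x) (auto simp: Fract_conv_to_fract)

lemma fract_poly_clear_denominators:
  fixes q :: "'a::idom fract poly"
  obtains r h where "r \<noteq> 0" and "smult (to_fract r) q = fract_poly h"
proof -
  have "\<exists>r h. r \<noteq> 0 \<and> smult (to_fract r) q = fract_poly h"
  proof (induction q)
    case 0
    show ?case by (rule exI[of _ 1], rule exI[of _ 0]) simp
  next
    case (pCons c q)
    then obtain r h where rh: "r \<noteq> 0" "smult (to_fract r) q = fract_poly h" by blast
    obtain a b where ab: "b \<noteq> 0" "c = to_fract a / to_fract b" by (rule fract_cases_to_fract)
    have "smult (to_fract (b * r)) (pCons c q) =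
        pCons (to_fract (r * a)) (smult (to_fract b) (smult (to_fract r) q))"
      using ab by (simp add: field_simps)
    also have "\<dots> = fract_poly (pCons (r * a) (smult b h))"
      unfolding rh(2) by (simp add: map_poly_pCons)
    finally show ?case using ab(1) rh(1) by (metis mult_eq_0_iff)
  qed
  then show thesis using that by blast
qed

lemma fract_poly_primitive_part_exists:
  fixes q :: "'a::idom fract poly"
  assumes "principal_ideal_domain TYPE('a)" and "q \<noteq> 0"
  obtains c h where "c \<noteq> 0" and "primitive h" and "q = smult c (fract_poly h)"
proof -
  obtain r k where rk: "r \<noteq> 0" "smult (to_fract r) q = fract_poly k"
    by (rule fract_poly_clear_denominators)
  have "k \<noteq> 0" using rk assms(2) by (metis fract_poly_0 smult_eq_0_iff to_fract_eq_0_iff)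
  then obtain c h where ch: "c \<noteq> 0" "primitive h" "k = smult c h"
    by (rule primitive_part_exists[OF assms(1)])
  have "q = smult (inverse (to_fract r)) (smult (to_fract r) q)"
    using rk(1) by simp
  also have "\<dots> = smult (to_fract c / to_fract r) (fract_poly h)"
    unfolding rk(2) ch(3) by (simp add: field_simps)
  finally show thesis using that[of "to_fract c / to_fract r" h] ch rk(1) by simp
qed

text \<open>Writing \<open>c\<close> as \<open>r / s\<close> gives
  \<open>smult r a = smult s b\<close>; as both polynomials are primitive, \<open>r\<close> and
  \<open>s\<close> divide each other.\<close>

lemma primitive_smult_fract_poly_eq:
  fixes a b :: "'a::idom poly"
  assumes "principal_ideal_domain TYPE('a)" and "primitive a" and "primitive b"
    and "smult c (fract_poly a) = fract_poly b"
  obtains u where "u dvd 1" and "c = to_fract u"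
proof -
  obtain r s where rs: "s \<noteq> 0" "c = to_fract r / to_fract s" by (rule fract_cases_to_fract)
  have "fract_poly (smult r a) = smult (to_fract s) (smult c (fract_poly a))"
    using rs by simp
  also have "\<dots> = fract_poly (smult s b)" using assms(4) by simp
  finally have "smult r a = smult s b" by (simp only: fract_poly_eq_iff)
  then have eq: "r * coeff a n = s * coeff b n" for n
    by (metis coeff_smult)
  have "s dvd r"
    by (rule primitive_dvd_of_dvd_mult_coeff[OF assms(1,2)]) (simp add: eq)
  then obtain u where u: "r = s * u" by (rule dvdE)
  have "r dvd s"
    by (rule primitive_dvd_of_dvd_mult_coeff[OF assms(1,3)]) (simp flip: eq)
  then have "s * u dvd s * 1" using u by simp
  then have "u dvd 1" using rs(1) by (simp only: dvd_mult_cancel_left) simp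
  moreover have "c = to_fract u" using rs u by simp
  ultimately show thesis using that by blast
qed

lemma poly_dvd_1_imp_degree_eq_0:
  "p dvd 1 \<Longrightarrow> degree p = 0" for p :: "'a::idom poly"
  using dvd_imp_degree_le[of p 1] by simp

text \<open>A constant primitive polynomial is a unit.\<close>

lemma primitive_irreducible_degree:
  assumes "primitive g" and "irreducible g"
  shows "degree g > 0"
proof (rule ccontr)
  assume "\<not> degree g > 0"
  then obtain c where c: "g = [:c:]" by (metis degree_eq_zeroE gr0I)
  have "c dvd 1" using assms(1) unfolding c primitive_def by (auto simp: coeff_pCons split: nat.splits)
  then have "g dvd 1" unfolding c by (simp add: is_unit_const_poly_iff)
  then show False using assms(2) irreducible_not_unit by blast
qed

text \<open>Factors over \<open>K\<close> are scalar multiples of primitive polynomials over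
  \<open>D\<close>, whose product is again primitive. Hence the scalars multiply to a unit of
  \<open>D\<close>, and the factorization descends to \<open>D[x]\<close>.\<close>

lemma irreducible_fract_poly:
  fixes g :: "'a::idom poly"
  assumes "principal_ideal_domain TYPE('a)" and "primitive g" and "irreducible g"
  shows "irreducible (fract_poly g)"
proof (rule irreducibleI)
  show "fract_poly g \<noteq> 0" using primitive_imp_nonzero[OF assms(2)] by simp
  have "degree (fract_poly g) > 0" using primitive_irreducible_degree[OF assms(2,3)] by simp
  then show "\<not> fract_poly g dvd 1" by (metis poly_dvd_1_imp_degree_eq_0 less_irrefl)
  fix A B assume AB: "fract_poly g = A * B"
  then have nz: "A \<noteq> 0" "B \<noteq> 0" using primitive_imp_nonzero[OF assms(2)] by auto
  obtain \<alpha> a where a: "\<alpha> \<noteq> 0" "primitive a" "A = smult \<alpha> (fract_poly a)"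
    by (rule fract_poly_primitive_part_exists[OF assms(1) nz(1)])
  obtain \<beta> b where b: "\<beta> \<noteq> 0" "primitive b" "B = smult \<beta> (fract_poly b)"
    by (rule fract_poly_primitive_part_exists[OF assms(1) nz(2)])
  have eq: "smult (\<alpha> * \<beta>) (fract_poly (a * b)) = fract_poly g"
    unfolding AB a(3) b(3) by (simp add: mult.commute)
  then obtain u where u: "u dvd 1" "\<alpha> * \<beta> = to_fract u"
    by (rule primitive_smult_fract_poly_eq[OF assms(1) primitive_mult[OF assms(1) a(2) b(2)] assms(2)])
  have "fract_poly g = fract_poly (smult u a * b)"
    unfolding eq[symmetric] u(2) by simp
  then have "g = smult u a * b" by (simp only: fract_poly_eq_iff)
  then have "smult u a dvd 1 \<or> b dvd 1" using assms(3) irreducibleD by blast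
  moreover have "u \<noteq> 0" using u(1) by auto
  ultimately have "degree a = 0 \<or> degree b = 0" by (auto dest!: poly_dvd_1_imp_degree_eq_0)
  then have "degree A = 0 \<or> degree B = 0" using a b by auto
  then show "A dvd 1 \<or> B dvd 1" using nz is_unit_iff_degree by blast
qed

lemma prime_elem_fract_poly:
  fixes g :: "'a::idom poly"
  assumes "principal_ideal_domain TYPE('a)" and "primitive g" and "irreducible g"
  shows "prime_elem (fract_poly g)"
  by (rule field_poly_irreducible_imp_prime) (rule irreducible_fract_poly[OF assms])

text \<open>The induction cancels one prime \<open>P m\<close> at a time from whichever of
  \<open>X\<close> and \<open>Y\<close> it divides; hence the cofactor \<open>Y\<close> is carried
  along.\<close>

lemma factor_of_prod_primes:
  fixes P :: "'i \<Rightarrow> 'k::field poly"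
  assumes "\<And>i. i \<in># M \<Longrightarrow> prime_elem (P i)" and "c \<noteq> 0"
    and "X * Y = smult c (\<Prod>i\<in>#M. P i)"
  obtains c' M' where "c' \<noteq> 0" and "M' \<subseteq># M" and "X = smult c' (\<Prod>i\<in>#M'. P i)"
proof -
  have "\<exists>c' M'. c' \<noteq> 0 \<and> M' \<subseteq># M \<and> X = smult c' (\<Prod>i\<in>#M'. P i)"
    using assms(1,3)
  proof (induction M arbitrary: X Y)
    case empty
    then have "X * Y = [:c:]" by simp
    moreover from this have "X \<noteq> 0" "Y \<noteq> 0" using assms(2) by auto
    ultimately have "degree X = 0" by (metis add_is_0 degree_mult_eq degree_pCons_0)
    then obtain c' where "X = [:c':]" by (rule degree_eq_zeroE)
    then show ?case using \<open>X \<noteq> 0\<close> by (intro exI[of _ c'] exI[of _ "{#}"]) auto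
  next
    case (add m M)
    have pm: "prime_elem (P m)" using add.prems(1) by simp
    have eq: "X * Y = P m * smult c (\<Prod>i\<in>#M. P i)" using add.prems(2) by simp
    then have "P m dvd X * Y" by (rule dvdI)
    then consider Z where "X = P m * Z" | Z where "Y = P m * Z"
      using prime_elem_dvd_multD[OF pm] by (meson dvdE)
    then show ?case
    proof cases
      case 1
      then have "P m * (Z * Y) = P m * smult c (\<Prod>i\<in>#M. P i)" using eq by (simp add: mult.assoc)
      then have "Z * Y = smult c (\<Prod>i\<in>#M. P i)"
        using prime_elem_not_zeroI[OF pm] mult_left_cancel by blast
      then obtain c' M' where "c' \<noteq> 0" "M' \<subseteq># M" "Z = smult c' (\<Prod>i\<in>#M'. P i)"
        using add.IH[of Z Y] add.prems(1) by auto
      then show ?thesis using 1 by (intro exI[of _ c'] exI[of _ "add_mset m M'"]) auto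
    next
      case 2
      then have "P m * (X * Z) = P m * smult c (\<Prod>i\<in>#M. P i)" using eq by (simp add: mult.left_commute)
      then have "X * Z = smult c (\<Prod>i\<in>#M. P i)"
        using prime_elem_not_zeroI[OF pm] mult_left_cancel by blast
      then obtain c' M' where "c' \<noteq> 0" "M' \<subseteq># M" "X = smult c' (\<Prod>i\<in>#M'. P i)"
        using add.IH[of X Z] add.prems(1) by auto
      moreover have "M \<subseteq># add_mset m M" by simp
      ultimately show ?thesis using subset_mset.order_trans by blast
    qed
  qed
  then show thesis using that by blast
qed


section \<open>Prime elements and valuations\<close>

lemma prime_elem_dvd_prodE:
  assumes "prime_elem p" and "p dvd (\<Prod>a\<in>A. f a)"
  obtains a where "a \<in> A" and "p dvd f a"
proof -
  have "\<exists>a\<in>A. p dvd f a" using assms(2)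
  proof (induction A rule: infinite_finite_induct)
    case (insert x A)
    then show ?case using prime_elem_dvd_multD[OF assms(1)] by auto
  qed (use prime_elem_not_unit[OF assms(1)] in auto)
  then show thesis using that by blast
qed

lemma prime_elem_dvd_imp_associated:
  fixes p q :: "'a::idom"
  assumes "prime_elem p" and "prime_elem q" and "p dvd q"
  shows "associated p q"
proof -
  obtain u where u: "q = p * u" using assms(3) by (rule dvdE)
  then have "q dvd p * u" by simp
  then have "q dvd p"
  proof (rule prime_elem_dvd_multD[OF assms(2), THEN disjE])
    assume "q dvd u"
    then obtain v where "u = q * v" by (rule dvdE)
    then have "q * (p * v) = q * 1" using u by (simp add: mult_ac)
    then have "p * v = 1" using prime_elem_not_zeroI[OF assms(2)] mult_left_cancel by blast
    then have "p dvd 1" using dvd_triv_left[of p v] by simp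
    then show ?thesis using prime_elem_not_unit[OF assms(1)] by blast
  qed
  then obtain v where v: "p = q * v" by (rule dvdE)
  then have "p * (u * v) = p * 1" using u by (simp add: mult_ac)
  then have "u * v = 1" using prime_elem_not_zeroI[OF assms(1)] mult_left_cancel by blast
  then have "v dvd 1" using dvd_triv_right[of v u] by simp
  then show ?thesis unfolding associated_def using v by (auto simp: mult.commute)
qed

lemma prime_elem_power_dvd_mult_cancel:
  fixes p :: "'a::idom"
  assumes "prime_elem p" and "\<not> p dvd a" and "p ^ n dvd a * b"
  shows "p ^ n dvd b"
  using assms(3)
proof (induction n arbitrary: b)
  case (Suc n)
  have "p dvd a * b" using Suc.prems by (auto intro: dvd_mult_left)
  then obtain c where c: "b = p * c"
    using prime_elem_dvd_multD[OF assms(1)] assms(2) by (meson dvdE)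
  then have "p * p ^ n dvd p * (a * c)" using Suc.prems by (simp add: mult_ac)
  then have "p ^ n dvd a * c" using prime_elem_not_zeroI[OF assms(1)] by (simp only: dvd_mult_cancel_left) simp
  then show ?case using Suc.IH[of c] c by (auto intro: mult_dvd_mono)
qed simp

lemma prime_elem_power_mult_eq_imp_exponent_eq:
  fixes p :: "'a::idom"
  assumes "prime_elem p" and "\<not> p dvd x" and "\<not> p dvd y" and "p ^ m * x = p ^ n * y"
  shows "m = n"
proof -
  have aux: "m \<le> n" if "\<not> p dvd x" "\<not> p dvd y" "p ^ m * x = p ^ n * y" for m n x y
  proof (rule ccontr)
    assume "\<not> m \<le> n"
    then obtain k where k: "m = n + Suc k" using less_imp_Suc_add by fastforce
    have "p ^ n * (p ^ Suc k * x) = p ^ n * y"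
      using that(3) unfolding k power_add by (simp add: mult.assoc)
    then have "p ^ Suc k * x = y"
      using prime_elem_not_zeroI[OF assms(1)] power_not_zero mult_left_cancel by blast
    then have "p dvd y" by auto
    then show False using that(2) by blast
  qed
  show ?thesis using aux[OF assms(2,3,4)] aux[OF assms(3,2) assms(4)[symmetric]] by simp
qed

text \<open>Pairwise non-associated primes are coprime, so their powers split off \<open>y\<close>
  one after another. Individual exponents are allowed because a denominator below mixes primes with
  squares of primes.\<close>

lemma prod_prime_elem_powers_dvd:
  fixes T :: "'a::idom set"
  assumes "finite T" and "\<And>p. p \<in> T \<Longrightarrow> prime_elem p"
    and "\<And>p q. p \<in> T \<Longrightarrow> q \<in> T \<Longrightarrow> p \<noteq> q \<Longrightarrow> \<not> associated p q"
    and "\<And>p. p \<in> T \<Longrightarrow> p ^ e p dvd y"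
  shows "(\<Prod>p\<in>T. p ^ e p) dvd y"
  using assms
proof (induction T rule: finite_induct)
  case (insert q T)
  then have "(\<Prod>p\<in>T. p ^ e p) dvd y" by auto
  then obtain z where z: "y = (\<Prod>p\<in>T. p ^ e p) * z" by (rule dvdE)
  have q: "prime_elem q" using insert.prems by simp
  have "\<not> q dvd (\<Prod>p\<in>T. p ^ e p)"
  proof
    assume "q dvd (\<Prod>p\<in>T. p ^ e p)"
    then obtain p where p: "p \<in> T" "q dvd p ^ e p" by (rule prime_elem_dvd_prodE[OF q])
    then have "q dvd p" using prime_elem_dvd_power[OF q] by blast
    then have "associated q p" using prime_elem_dvd_imp_associated[OF q] insert.prems(1) p(1) by simp
    then show False using insert.prems(2)[of q p] p(1) insert.hyps by auto
  qed
  moreover have "q ^ e q dvd (\<Prod>p\<in>T. p ^ e p) * z" using insert.prems(3)[of q] z by simp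
  ultimately have "q ^ e q dvd z" using prime_elem_power_dvd_mult_cancel[OF q] by blast
  then show ?case unfolding z using insert.hyps by (simp add: mult.commute mult_dvd_mono)
qed simp

text \<open>If \<open>p\<close> divides the product, it is associated to one \<open>q\<close> in
  \<open>T\<close> and divides no other element of \<open>T\<close>, so \<open>p ^ 2\<close> would
  have to divide \<open>q\<close>.\<close>

lemma prime_elem_square_not_dvd_prod:
  fixes T :: "'a::idom set"
  assumes "finite T" and "\<And>p. p \<in> T \<Longrightarrow> prime_elem p"
    and "\<And>p q. p \<in> T \<Longrightarrow> q \<in> T \<Longrightarrow> p \<noteq> q \<Longrightarrow> \<not> associated p q"
    and p: "prime_elem p"
  shows "\<not> p ^ 2 dvd (\<Prod>q\<in>T. q)"
proof
  assume sq: "p ^ 2 dvd (\<Prod>q\<in>T. q)"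
  then have "p dvd (\<Prod>q\<in>T. q)" by (simp add: power2_eq_square dvd_mult_left)
  then obtain q where q: "q \<in> T" "p dvd q" by (rule prime_elem_dvd_prodE[OF p])
  then obtain u where u: "p = u * q" "u dvd 1"
    using prime_elem_dvd_imp_associated[OF p] assms(2) unfolding associated_def by blast
  have "\<not> p dvd (\<Prod>q\<in>T - {q}. q)"
  proof
    assume "p dvd (\<Prod>q\<in>T - {q}. q)"
    then obtain q' where q': "q' \<in> T - {q}" "p dvd q'" by (rule prime_elem_dvd_prodE[OF p])
    then have "q dvd q'" using u(1) dvd_mult_right by blast
    then show False using prime_elem_dvd_imp_associated[of q q'] assms(2,3) q(1) q'(1) by blast
  qed
  moreover have "(\<Prod>q\<in>T. q) = (\<Prod>q\<in>T - {q}. q) * q"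
    using prod.remove[OF assms(1) q(1), of "\<lambda>q. q"] by (simp add: mult.commute)
  ultimately have "p ^ 2 dvd q" using sq prime_elem_power_dvd_mult_cancel[OF p] by metis
  then have "q * (u * p) dvd q * 1" using u(1) by (simp add: power2_eq_square mult_ac)
  then have "u * p dvd 1" using prime_elem_not_zeroI[OF assms(2)[OF q(1)]] by (simp only: dvd_mult_cancel_left) simp
  then show False using prime_elem_not_unit[OF p] dvd_mult_right by blast
qed

text \<open>The factor \<open>h i\<close> has valuation 1 and all others have valuation 0, so the
  valuation of the product counts the occurrences of \<open>i\<close>.\<close>

lemma dvd_power_multiplicity_prod_mset:
  fixes p :: "'a::idom"
  assumes "prime_elem p" and "p dvd h i" and "\<not> p ^ 2 dvd h i"
    and "\<And>j. j \<in># M \<Longrightarrow> j \<noteq> i \<Longrightarrow> \<not> p dvd h j"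
  obtains m where "\<not> p dvd m" and "(\<Prod>j\<in>#M. h j) = p ^ count M i * m"
proof -
  obtain x where x: "h i = p * x" using assms(2) by (rule dvdE)
  then have nx: "\<not> p dvd x" using assms(3) by (auto simp: power2_eq_square intro: mult_dvd_mono)
  have "\<exists>m. \<not> p dvd m \<and> (\<Prod>j\<in>#M. h j) = p ^ count M i * m"
    using assms(4)
  proof (induction M)
    case empty
    show ?case using prime_elem_not_unit[OF assms(1)] by auto
  next
    case (add j M)
    then obtain m where m: "\<not> p dvd m" "(\<Prod>j\<in>#M. h j) = p ^ count M i * m" by auto
    show ?case
    proof (cases "j = i")
      case True
      have "\<not> p dvd x * m" using nx m(1) prime_elem_dvd_multD[OF assms(1)] by blast
      then show ?thesis using m(2) x True by (intro exI[of _ "x * m"]) (simp add: mult_ac)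
    next
      case False
      then have "\<not> p dvd h j * m" using add.prems m(1) prime_elem_dvd_multD[OF assms(1)] by auto
      then show ?thesis using m(2) False by (intro exI[of _ "h j * m"]) (simp add: mult_ac)
    qed
  qed
  then show thesis using that by blast
qed

lemma valuation_eq_0_iff: "valuation p x = 0 \<longleftrightarrow> \<not> p dvd x"
proof
  assume "valuation p x = 0"
  then have "\<forall>n. p ^ n dvd x \<longrightarrow> n = 0"
    unfolding valuation_def by (metis (mono_tags, lifting) Sup_upper enat_0_iff(1) i0_lb mem_Collect_eq order_antisym)
  then show "\<not> p dvd x" by (metis one_neq_zero power_one_right)
next
  assume "\<not> p dvd x"
  then have "n = 0" if "p ^ n dvd x" for n
    using that by (metis dvd_power dvd_trans gr0I)
  then have "{enat n | n. p ^ n dvd x} = {0}" by (auto simp: zero_enat_def)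
  then show "valuation p x = 0" unfolding valuation_def by simp
qed

lemma valuation_eq_1_iff: "valuation p x = 1 \<longleftrightarrow> p dvd x \<and> \<not> p ^ 2 dvd x"
proof
  assume v: "valuation p x = 1"
  then have "p dvd x" using valuation_eq_0_iff[of p x] by auto
  moreover have "\<not> p ^ 2 dvd x"
  proof
    assume "p ^ 2 dvd x"
    then have "enat 2 \<le> valuation p x" unfolding valuation_def by (intro Sup_upper) auto
    then show False using v by (simp add: one_enat_def)
  qed
  ultimately show "p dvd x \<and> \<not> p ^ 2 dvd x" ..
next
  assume *: "p dvd x \<and> \<not> p ^ 2 dvd x"
  have "n \<le> 1" if "p ^ n dvd x" for n
  proof (rule ccontr)
    assume "\<not> n \<le> 1"
    then have "p ^ 2 dvd p ^ n" by (intro le_imp_power_dvd) simp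
    then show False using that * dvd_trans by blast
  qed
  then have "valuation p x \<le> 1" unfolding valuation_def by (intro Sup_least) (auto simp: one_enat_def)
  moreover have "enat 1 \<le> valuation p x" unfolding valuation_def using * by (intro Sup_upper) (auto intro: exI[of _ 1])
  ultimately show "valuation p x = 1" by (simp add: one_enat_def)
qed

text \<open>Gives the independence of \<open>quintessential\<close> from the chosen generator of the
  fixed divisor.\<close>

lemma valuation_cong_dvd:
  assumes "x dvd y" and "y dvd x"
  shows "valuation p x = valuation p y"
proof -
  have "p ^ n dvd x \<longleftrightarrow> p ^ n dvd y" for n using assms dvd_trans by blast
  then show ?thesis unfolding valuation_def by simp
qed


section \<open>Integer-valued polynomials\<close>

lemmas poly_of_int_valued_mult = times_int_valued_poly.rep_eq

lemma poly_of_int_valued_power: "poly_of_int_valued (F ^ n) = poly_of_int_valued F ^ n"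
  by (induction n) (simp_all add: one_int_valued_poly.rep_eq poly_of_int_valued_mult)

lemma poly_of_int_valued_eq_0_iff: "poly_of_int_valued F = 0 \<longleftrightarrow> F = 0"
  by transfer simp

lift_definition int_valued_const :: "'a::idom \<Rightarrow> 'a int_valued_poly" is "\<lambda>c. [:to_fract c:]"
  by simp

lemma int_valued_const_dvd_1: "c dvd 1 \<Longrightarrow> int_valued_const c dvd 1"
proof (erule dvdE)
  fix d assume d: "1 = c * d"
  have "1 = int_valued_const c * int_valued_const d"
    using d by transfer (simp add: mult.commute one_pCons flip: to_fract_mult)
  then show ?thesis by (rule dvdI)
qed

text \<open>The value exists since \<open>F\<close> is integer-valued and is unique since
  \<open>to_fract\<close> is injective. It moves questions about divisibility of values from
  \<open>K\<close> to \<open>D\<close>.\<close>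

definition int_value :: "'a::idom int_valued_poly \<Rightarrow> 'a \<Rightarrow> 'a"
  where "int_value F w = (THE b. poly (poly_of_int_valued F) (to_fract w) = to_fract b)"

lemma to_fract_int_value [simp]:
  "to_fract (int_value F w) = poly (poly_of_int_valued F) (to_fract w)"
proof -
  obtain b where "poly (poly_of_int_valued F) (to_fract w) = to_fract b"
    using poly_of_int_valued[of F] by auto
  then show ?thesis unfolding int_value_def by (auto intro: theI2)
qed

lemma int_value_mult [simp]: "int_value (F * G) w = int_value F w * int_value G w"
  by (simp flip: to_fract_eq_iff add: poly_of_int_valued_mult)

lemma int_value_1 [simp]: "int_value 1 w = 1"
  by (simp flip: to_fract_eq_iff add: one_int_valued_poly.rep_eq)

lemma int_value_power [simp]: "int_value (F ^ n) w = int_value F w ^ n"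
  by (induction n) simp_all

lemma int_value_const [simp]: "int_value (int_valued_const c) w = c"
  by (simp flip: to_fract_eq_iff add: int_valued_const.rep_eq)

lemma degree_0_int_valued_const:
  assumes "degree (poly_of_int_valued F) = 0"
  obtains c where "F = int_valued_const c"
proof -
  obtain k where k: "poly_of_int_valued F = [:k:]" using assms by (rule degree_eq_zeroE)
  then have "k = to_fract (int_value F 0)" by simp
  then have "F = int_valued_const (int_value F 0)"
    using k by (simp add: int_valued_const.rep_eq flip: poly_of_int_valued_inject)
  then show thesis by (rule that)
qed

lemma int_valued_degree_mult:
  "F * G \<noteq> 0 \<Longrightarrow> degree (poly_of_int_valued (F * G)) =
    degree (poly_of_int_valued F) + degree (poly_of_int_valued G)"
  by (simp add: poly_of_int_valued_mult degree_mult_eq poly_of_int_valued_eq_0_iff)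

lemma int_valued_degree_power:
  "degree (poly_of_int_valued (F ^ n)) = n * degree (poly_of_int_valued F)"
  by (cases "poly_of_int_valued F = 0") (simp_all add: poly_of_int_valued_power degree_power_eq power_0_left)

lemma int_valued_dvd_1_imp_degree_eq_0:
  assumes "F dvd (1 :: 'a::idom int_valued_poly)"
  shows "degree (poly_of_int_valued F) = 0"
proof -
  obtain G where "1 = F * G" using assms by (rule dvdE)
  then show ?thesis using int_valued_degree_mult[of F G] by (simp add: one_int_valued_poly.rep_eq)
qed

lemma image_primitive_iff: "image_primitive F \<longleftrightarrow> 1 \<in> ideal_generated_by (range (int_value F))"
proof -
  have "{b. \<exists>a. poly (poly_of_int_valued F) (to_fract a) = to_fract b} = range (int_value F)"
    by (auto simp flip: to_fract_int_value)
  then have "image_primitive F \<longleftrightarrow> ideal_generated_by (range (int_value F)) = UNIV"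
    unfolding image_primitive_def fixed_divisor_def by simp
  also have "\<dots> \<longleftrightarrow> 1 \<in> ideal_generated_by (range (int_value F))"
  proof
    assume 1: "1 \<in> ideal_generated_by (range (int_value F))"
    have "x \<in> ideal_generated_by (range (int_value F))" for x
      using module.span_scale[OF module_mult 1, of x] by simp
    then show "ideal_generated_by (range (int_value F)) = UNIV" by blast
  qed simp
  finally show ?thesis .
qed

text \<open>A prime dividing all values of \<open>F ^ n\<close> divides all values of
  \<open>F\<close>.\<close>

lemma image_primitive_power:
  fixes F :: "'a::idom int_valued_poly"
  assumes "principal_ideal_domain TYPE('a)" and "image_primitive F"
  shows "image_primitive (F ^ n)"
proof (rule ccontr)
  assume "\<not> image_primitive (F ^ n)"
  then have n1: "1 \<notin> ideal_generated_by (range (int_value (F ^ n)))"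
    by (simp add: image_primitive_iff)
  have 1: "1 \<in> ideal_generated_by (range (int_value F))"
    using assms(2) by (simp add: image_primitive_iff)
  \<comment> \<open>If all values vanished, \<open>0\<close> would divide \<open>1\<close>. The
    non-zero value secures the prime divisor below.\<close>
  obtain w where "int_value F w \<noteq> 0"
    using dvd_of_mem_ideal_generated_by[OF 1, of 0] by auto
  then have "int_value (F ^ n) w \<noteq> 0" by simp
  then obtain p where p: "prime_elem p" "\<And>x. x \<in> range (int_value (F ^ n)) \<Longrightarrow> p dvd x"
    by (rule principal_ideal_domain_prime_dvd_generators[OF assms(1) n1 rangeI]) blast
  have "p dvd int_value F w" for w
    using p(2)[of "int_value (F ^ n) w"] prime_elem_dvd_power[OF p(1)] by simp
  then have "p dvd 1" by (intro dvd_of_mem_ideal_generated_by[OF 1]) auto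
  then show False using prime_elem_not_unit[OF p(1)] by blast
qed

lemma image_primitive_int_valued_const_dvd:
  assumes "image_primitive F" and "int_valued_const c dvd F"
  shows "c dvd 1"
proof (rule dvd_of_mem_ideal_generated_by[OF assms(1)[unfolded image_primitive_iff]])
  obtain G where "F = int_valued_const c * G" using assms(2) by (rule dvdE)
  then show "c dvd x" if "x \<in> range (int_value F)" for x using that by auto
qed

text \<open>For \<open>c\<close> equal to \<open>r / s\<close>, the element \<open>s\<close> divides
  \<open>r\<close> times every value of \<open>G\<close>; these values generate the unit ideal, so
  \<open>s\<close> divides \<open>r\<close> and \<open>c\<close> lies in \<open>D\<close>.\<close>

lemma image_primitive_smult:
  fixes F G :: "'a::idom int_valued_poly"
  assumes "image_primitive G" and "poly_of_int_valued F = smult c (poly_of_int_valued G)"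
  obtains u where "F = int_valued_const u * G"
proof -
  obtain r s where rs: "s \<noteq> 0" "c = to_fract r / to_fract s" by (rule fract_cases_to_fract)
  have "to_fract (s * int_value F w) = to_fract (r * int_value G w)" for w
    using rs assms(2) by simp
  then have *: "s * int_value F w = r * int_value G w" for w by (simp only: to_fract_eq_iff)
  have "s dvd r * 1"
    by (rule dvd_mult_of_mem_ideal_generated_by[OF assms(1)[unfolded image_primitive_iff]])
      (auto simp flip: *)
  then obtain u where "r = s * u" by (auto elim: dvdE)
  then have "c = to_fract u" using rs by simp
  then have "F = int_valued_const u * G"
    using assms(2) by (simp add: poly_of_int_valued_mult int_valued_const.rep_eq flip: poly_of_int_valued_inject)
  then show thesis by (rule that)
qed

section \<open>Factorizations into irreducibles in \<open>Int(D)\<close>\<close>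

text \<open>By the hypothesis on constants, a divisor that is not a unit has positive degree. So
  both factors of a proper splitting have smaller degree, and induction on the degree
  applies.\<close>

lemma irreducible_factorization_exists:
  fixes F :: "'a::idom int_valued_poly"
  assumes "degree (poly_of_int_valued F) > 0" and "\<And>c. int_valued_const c dvd F \<Longrightarrow> c dvd 1"
  obtains A where "irreducible_factorization A F"
proof -
  have "\<exists>A. irreducible_factorization A F" using assms
  proof (induction "degree (poly_of_int_valued F)" arbitrary: F rule: less_induct)
    case less
    have F0: "F \<noteq> 0" using less.prems(1) by (metis degree_0 less_irrefl zero_int_valued_poly.rep_eq)
    have Fu: "\<not> F dvd 1" using less.prems(1) int_valued_dvd_1_imp_degree_eq_0 by (metis less_irrefl)
    show ?case
    proof (cases "irreducible F")
      case True
      then show ?thesis by (intro exI[of _ "{#F#}"]) (simp add: irreducible_factorization_def)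
    next
      case False
      then obtain G H where GH: "F = G * H" "\<not> G dvd 1" "\<not> H dvd 1"
        using F0 Fu unfolding irreducible_def by blast
      have pos: "degree (poly_of_int_valued E) > 0" if "E dvd F" "\<not> E dvd 1" for E
      proof (rule ccontr)
        assume "\<not> degree (poly_of_int_valued E) > 0"
        then obtain c where "E = int_valued_const c" by (auto elim: degree_0_int_valued_const)
        then show False using that less.prems(2) int_valued_const_dvd_1 by blast
      qed
      have dvd: "G dvd F" "H dvd F" unfolding GH(1) by simp_all
      have deg: "degree (poly_of_int_valued F) = degree (poly_of_int_valued G) + degree (poly_of_int_valued H)"
        using int_valued_degree_mult[of G H] F0 unfolding GH(1) by blast
      obtain A where A: "irreducible_factorization A G"
        using less.hyps[of G] pos[OF dvd(1) GH(2)] pos[OF dvd(2) GH(3)] deg less.prems(2) dvd(1) dvd_trans by fastforce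
      obtain B where B: "irreducible_factorization B H"
        using less.hyps[of H] pos[OF dvd(1) GH(2)] pos[OF dvd(2) GH(3)] deg less.prems(2) dvd(2) dvd_trans by fastforce
      have "irreducible_factorization (A + B) F"
        using A B unfolding irreducible_factorization_def GH(1) by auto
      then show ?thesis ..
    qed
  qed
  then show thesis using that by blast
qed

lemma essentially_same_replicate_mset_iff:
  "essentially_same A (replicate_mset n c) \<longleftrightarrow> size A = n \<and> (\<forall>a\<in>#A. associated a c)"
proof
  assume "essentially_same A (replicate_mset n c)"
  then show "size A = n \<and> (\<forall>a\<in>#A. associated a c)"
    unfolding essentially_same_def
  proof (induction A arbitrary: n)
    case empty
    then show ?case using rel_mset_size by fastforce
  next
    case (add a A)
    from msed_rel_invL[OF add.prems] obtain N b where N: "replicate_mset n c = add_mset b N"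
      "associated a b" "rel_mset associated A N" by blast
    then have "b = c" by (metis in_replicate_mset union_single_eq_member)
    have "n > 0" using N(1) by (cases n) auto
    then obtain m where n: "n = Suc m" using gr0_implies_Suc by blast
    then have "N = replicate_mset m c" using N(1) \<open>b = c\<close> by simp
    then show ?case using add.IH[of m] N n \<open>b = c\<close> by auto
  qed
next
  assume "size A = n \<and> (\<forall>a\<in>#A. associated a c)"
  then show "essentially_same A (replicate_mset n c)"
    unfolding essentially_same_def
    by (induction A arbitrary: n) (auto simp: rel_mset_Zero intro: rel_mset_Plus)
qed

text \<open>Associated elements have equal degree; this later lets degrees determine the number of
  factors.\<close>

lemma degree_prod_mset_associated:
  fixes f :: "'a::idom int_valued_poly"
  assumes "f \<noteq> 0" and "\<And>a. a \<in># A \<Longrightarrow> associated a f"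
  shows "degree (poly_of_int_valued (prod_mset A)) = size A * degree (poly_of_int_valued f)"
proof -
  have "degree (poly_of_int_valued (prod_mset A)) = size A * degree (poly_of_int_valued f) \<and> prod_mset A \<noteq> 0"
    using assms(2)
  proof (induction A)
    case (add a A)
    obtain u where u: "u dvd 1" "a = u * f" using add.prems unfolding associated_def by auto
    have "u \<noteq> 0" using u(1) by auto
    then have "degree (poly_of_int_valued a) = degree (poly_of_int_valued f)" "a \<noteq> 0"
      using int_valued_degree_mult[of u f] int_valued_dvd_1_imp_degree_eq_0[OF u(1)] assms(1) u(2) by auto
    then show ?case using add int_valued_degree_mult[of a "prod_mset A"] by auto
  qed (simp add: one_int_valued_poly.rep_eq)
  then show ?thesis ..
qed


section \<open>The quintessential graph and absolute irreducibility\<close>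

locale image_primitive_standard_form =
  fixes f :: "'a::idom int_valued_poly"
    and g :: "'i \<Rightarrow> 'a poly" and I :: "'i set" and T :: "'a set"
  assumes pid: "principal_ideal_domain TYPE('a)"
    and degree_f: "degree (poly_of_int_valued f) > 0"
    and image_primitive_f: "image_primitive f"
    and finite_I: "finite I" and I_nonempty: "I \<noteq> {}"
    and primitive_g: "\<And>i. i \<in> I \<Longrightarrow> primitive (g i)"
    and irreducible_g: "\<And>i. i \<in> I \<Longrightarrow> irreducible (g i)"
    and finite_T: "finite T"
    and prime_T: "\<And>p. p \<in> T \<Longrightarrow> prime_elem p"
    and not_associated_T: "\<And>p q. p \<in> T \<Longrightarrow> q \<in> T \<Longrightarrow> p \<noteq> q \<Longrightarrow> \<not> associated p q"
    and rep_f: "poly_of_int_valued f =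
      smult (inverse (to_fract (\<Prod>p\<in>T. p))) (fract_poly (\<Prod>i\<in>I. g i))"
begin

abbreviation N :: 'a where "N \<equiv> (\<Prod>p\<in>T. p)"

section \<open>Fixed divisor of the numerator and witnesses of quintessence\<close>

lemma prod_subset_T_nonzero: "S \<subseteq> T \<Longrightarrow> (\<Prod>p\<in>S. p) \<noteq> 0"
  using prime_T prime_elem_not_zeroI finite_subset[OF _ finite_T] by fastforce

lemma f_nonzero: "f \<noteq> 0"
  using degree_f by (metis degree_0 less_irrefl zero_int_valued_poly.rep_eq)

lemma f_not_unit: "\<not> f dvd 1"
  using degree_f int_valued_dvd_1_imp_degree_eq_0 by (metis less_irrefl)

lemma N_mult_int_value: "N * int_value f w = (\<Prod>i\<in>I. poly (g i) w)"
proof -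
  have "to_fract (N * int_value f w) = to_fract (poly (\<Prod>i\<in>I. g i) w)"
    using prod_subset_T_nonzero[of T] by (simp add: rep_f del: prod_zero_iff)
  then show ?thesis by (simp only: to_fract_eq_iff poly_prod)
qed

text \<open>The values of the numerator are \<open>N\<close> times those of \<open>f\<close>, and
  the latter generate the unit ideal.\<close>

lemma fixed_divisor_prod_g:
  "fixed_divisor (fract_poly (\<Prod>i\<in>I. g i)) = ideal_generated_by {N}"
proof -
  let ?S = "range (\<lambda>w. N * int_value f w)"
  have S: "{b. \<exists>a. poly (fract_poly (\<Prod>i\<in>I. g i)) (to_fract a) = to_fract b} = ?S"
    by (auto simp: N_mult_int_value poly_prod)
  obtain d where d: "d \<in> ideal_generated_by ?S" "\<And>x. x \<in> ?S \<Longrightarrow> d dvd x"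
    by (rule principal_ideal_domain_gcd[OF pid, of ?S]) blast
  have "d dvd N * 1"
    by (rule dvd_mult_of_mem_ideal_generated_by[OF image_primitive_f[unfolded image_primitive_iff]])
      (use d(2) in auto)
  then obtain e where "N = e * d" by (auto simp: dvd_def mult.commute)
  then have "N \<in> ideal_generated_by ?S"
    using module.span_scale[OF module_mult d(1), of e] by simp
  moreover have "?S \<subseteq> ideal_generated_by {N}"
    by (auto simp: mem_ideal_generated_by_singleton)
  ultimately have "ideal_generated_by ?S = ideal_generated_by {N}"
    by (intro subset_antisym module.span_minimal[OF module_mult] module.subspace_span[OF module_mult]) auto
  then show ?thesis unfolding fixed_divisor_def S .
qed

text \<open>Since \<open>N\<close> is square-free, its valuation at a prime dividing it is 1, so the
  condition on \<open>w\<close> becomes one of exact divisibility.\<close>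

lemma quintessential_iff:
  assumes "prime_elem p"
  shows "quintessential g I p i \<longleftrightarrow> p dvd N \<and>
    (\<exists>w. p dvd poly (g i) w \<and> \<not> p ^ 2 dvd poly (g i) w \<and> (\<forall>j\<in>I - {i}. \<not> p dvd poly (g j) w))"
proof -
  have d: "ideal_generated_by {N} = ideal_generated_by {d} \<longleftrightarrow> N dvd d \<and> d dvd N" for d
    unfolding set_eq_iff mem_ideal_generated_by_singleton
    by (rule iffI, rule conjI, erule allE[of _ d], simp, erule allE[of _ N], simp) (blast intro: dvd_trans)
  have N1: "valuation p N = 1 \<longleftrightarrow> p dvd N"
    unfolding valuation_eq_1_iff
    using prime_elem_square_not_dvd_prod[OF finite_T prime_T not_associated_T assms] by blast
  let ?W = "\<lambda>d. \<exists>w. valuation p (poly (g i) w) = valuation p d \<and>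
    (\<forall>j\<in>I - {i}. valuation p (poly (g j) w) = 0)"
  have "quintessential g I p i \<longleftrightarrow> (\<exists>d. N dvd d \<and> d dvd N \<and> p dvd d \<and> ?W d)"
    unfolding quintessential_def fixed_divisor_prod_g d by simp
  also have "\<dots> \<longleftrightarrow> p dvd N \<and> ?W N"
  proof
    assume "\<exists>d. N dvd d \<and> d dvd N \<and> p dvd d \<and> ?W d"
    then obtain d where *: "N dvd d" "d dvd N" "p dvd d" "?W d" by blast
    then show "p dvd N \<and> ?W N" using valuation_cong_dvd[OF *(1,2), of p] dvd_trans by simp
  next
    assume "p dvd N \<and> ?W N"
    then show "\<exists>d. N dvd d \<and> d dvd N \<and> p dvd d \<and> ?W d"
      by - (rule exI[of _ N], intro conjI dvd_refl, blast+)
  qed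
  finally have *: "quintessential g I p i \<longleftrightarrow> p dvd N \<and> ?W N" .
  show ?thesis
  proof (cases "p dvd N")
    case True
    then have v: "valuation p N = 1" using N1 by blast
    show ?thesis unfolding * v valuation_eq_1_iff valuation_eq_0_iff by (simp only: conj_assoc)
  next
    case False
    then show ?thesis unfolding * by blast
  qed
qed

text \<open>Otherwise \<open>p ^ 2\<close> would divide \<open>N * int_value f w\<close>, the
  product of all \<open>poly (g j) w\<close>; the factors with \<open>j \<noteq> i\<close> are prime
  to \<open>p\<close> and can be cancelled.\<close>

lemma quintessential_imp_prime_not_dvd_int_value:
  assumes p: "prime_elem p" and "p dvd N" and i: "i \<in> I"
    and "\<not> p ^ 2 dvd poly (g i) w" and "\<forall>j\<in>I - {i}. \<not> p dvd poly (g j) w"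
  shows "\<not> p dvd int_value f w"
proof
  assume "p dvd int_value f w"
  then have "p ^ 2 dvd N * int_value f w"
    unfolding power2_eq_square using assms(2) by (intro mult_dvd_mono)
  also have "N * int_value f w = (\<Prod>j\<in>I - {i}. poly (g j) w) * poly (g i) w"
    unfolding N_mult_int_value using prod.remove[OF finite_I i] by (simp add: mult.commute)
  finally have sq: "p ^ 2 dvd (\<Prod>j\<in>I - {i}. poly (g j) w) * poly (g i) w" .
  have "\<not> p dvd (\<Prod>j\<in>I - {i}. poly (g j) w)"
    using prime_elem_dvd_prodE[OF p] assms(5) by metis
  then show False using prime_elem_power_dvd_mult_cancel[OF p _ sq] assms(4) by blast
qed

section \<open>Divisors of powers of \<open>f\<close>, and the case of a connected graph\<close>

lemma fract_poly_prod_g_power: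
  "smult (inverse (to_fract N)) (fract_poly (\<Prod>i\<in>I. g i)) ^ n =
    smult (inverse (to_fract N) ^ n) (\<Prod>i\<in>#repeat_mset n (mset_set I). fract_poly (g i))"
proof -
  have "(\<Prod>i\<in>#repeat_mset n M. h i) = (\<Prod>i\<in>#M. h i) ^ n"
    for M :: "'i multiset" and h :: "'i \<Rightarrow> 'a fract poly"
    by (induction n) simp_all
  then show ?thesis
    by (simp add: smult_power fract_poly_prod) (simp add: prod_unfold_prod_mset)
qed

text \<open>Unique factorization in \<open>K[x]\<close>, the \<open>fract_poly (g i)\<close> being
  prime there. The multiset \<open>M\<close> need not be unique, since distinct indices may carry
  the same polynomial.\<close>

lemma divisor_of_power_representation:
  assumes "F * H = f ^ n"
  obtains c M where "c \<noteq> 0" and "set_mset M \<subseteq> I"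
    and "poly_of_int_valued F = smult c (\<Prod>i\<in>#M. fract_poly (g i))"
proof -
  let ?M = "repeat_mset n (mset_set I)"
  have "poly_of_int_valued F * poly_of_int_valued H =
      smult (inverse (to_fract N) ^ n) (\<Prod>i\<in>#?M. fract_poly (g i))"
    unfolding poly_of_int_valued_mult[symmetric] assms poly_of_int_valued_power rep_f fract_poly_prod_g_power ..
  moreover have "i \<in> I" if "i \<in># ?M" for i
    using that finite_I by (metis count_greater_zero_iff count_mset_set(3) count_repeat_mset mult_0_right less_irrefl)
  then have "prime_elem (fract_poly (g i))" if "i \<in># ?M" for i
    using that prime_elem_fract_poly[OF pid primitive_g irreducible_g] by blast
  moreover have "inverse (to_fract N) ^ n \<noteq> 0"
    using prod_subset_T_nonzero[of T] by (simp del: prod_zero_iff)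
  ultimately obtain c M where cM: "c \<noteq> 0" "M \<subseteq># ?M"
    "poly_of_int_valued F = smult c (\<Prod>i\<in>#M. fract_poly (g i))"
    using factor_of_prod_primes[of ?M "\<lambda>i. fract_poly (g i)"] by metis
  have "set_mset M \<subseteq> I"
    using set_mset_mono[OF cM(2)] \<open>\<And>i. i \<in># ?M \<Longrightarrow> i \<in> I\<close> by blast
  then show thesis using that cM by blast
qed

text \<open>Both counts are the negative of the valuation of \<open>c\<close>. To stay inside
  \<open>D\<close>, the values at the two witnesses are compared instead of assigning a valuation to
  \<open>c\<close>.\<close>

lemma quintessential_same_prime_imp_count_eq:
  assumes "F * H = f ^ n" and "c \<noteq> 0" and M: "set_mset M \<subseteq> I"
    and F: "poly_of_int_valued F = smult c (\<Prod>i\<in>#M. fract_poly (g i))"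
    and p: "prime_elem p" and "i \<in> I" and "j \<in> I"
    and "quintessential g I p i" and "quintessential g I p j"
  shows "count M i = count M j"
proof -
  let ?P = "\<lambda>w. \<Prod>k\<in>#M. poly (g k) w"
  have witness: "\<exists>w m. \<not> p dvd int_value F w \<and> \<not> p dvd m \<and> ?P w = p ^ count M k * m"
    if k: "k \<in> I" and q: "quintessential g I p k" for k
  proof -
    obtain w where w: "p dvd N" "p dvd poly (g k) w" "\<not> p ^ 2 dvd poly (g k) w"
      "\<forall>j\<in>I - {k}. \<not> p dvd poly (g j) w"
      using q unfolding quintessential_iff[OF p] by blast
    obtain m where "\<not> p dvd m" "?P w = p ^ count M k * m"
      using dvd_power_multiplicity_prod_mset[OF p, of "\<lambda>k. poly (g k) w" k M] w(2-4) M by blast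
    moreover have "\<not> p dvd int_value F w"
    proof
      assume "p dvd int_value F w"
      then have "p dvd int_value (F * H) w" by simp
      then have "p dvd int_value f w" using prime_elem_dvd_power[OF p] unfolding assms(1) by simp
      then show False
        using quintessential_imp_prime_not_dvd_int_value[OF p w(1) k w(3,4)] by blast
    qed
    ultimately show ?thesis by blast
  qed
  have F_value: "to_fract (int_value F w) = c * to_fract (?P w)" for w
  proof -
    have "poly (\<Prod>i\<in>#M. fract_poly (g i)) (to_fract w) = to_fract (?P w)"
      by (induction M) simp_all
    then show ?thesis by (simp add: F)
  qed
  obtain v m where v: "\<not> p dvd int_value F v" "\<not> p dvd m" "?P v = p ^ count M i * m"
    using witness assms(6,8) by blast
  obtain w l where w: "\<not> p dvd int_value F w" "\<not> p dvd l" "?P w = p ^ count M j * l"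
    using witness assms(7,9) by blast
  \<comment> \<open>Both sides are \<open>c\<close> times the product of \<open>?P v\<close> and
    \<open>?P w\<close>, so \<open>c\<close> drops out.\<close>
  have "to_fract (?P v * int_value F w) = to_fract (?P w * int_value F v)"
    unfolding to_fract_mult F_value by (simp add: mult_ac)
  then have "p ^ count M i * (m * int_value F w) = p ^ count M j * (l * int_value F v)"
    unfolding v(3) w(3) by (simp only: to_fract_eq_iff mult.assoc)
  moreover have "\<not> p dvd m * int_value F w" "\<not> p dvd l * int_value F v"
    using v w prime_elem_dvd_multD[OF p] by blast+
  ultimately show ?thesis using prime_elem_power_mult_eq_imp_exponent_eq[OF p] by blast
qed

lemma connected_imp_count_eq:
  assumes "Digraph_Component.connected (quintessential_graph g I)"
    and "F * H = f ^ n" and "c \<noteq> 0" and "set_mset M \<subseteq> I"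
    and "poly_of_int_valued F = smult c (\<Prod>i\<in>#M. fract_poly (g i))"
    and "i \<in> I" and "j \<in> I"
  shows "count M i = count M j"
proof -
  let ?G = "mk_symmetric (quintessential_graph g I)"
  have "i \<rightarrow>\<^sup>*\<^bsub>with_proj ?G\<^esub> j"
    using assms(1,6,7) unfolding Digraph_Component.connected_def strongly_connected_def
    by (simp add: quintessential_graph_def)
  then have "(i, j) \<in> (arcs_ends (with_proj ?G))\<^sup>*" by (rule reachable_rtranclI)
  then show ?thesis
  proof (induction rule: rtrancl_induct)
    case (step k l)
    \<comment> \<open>\<open>connected\<close> refers to the symmetric closure, where an arc may
      stem from either orientation.\<close>
    then have "(k, l) \<in> parcs (quintessential_graph g I) \<or> (l, k) \<in> parcs (quintessential_graph g I)"
      by (auto simp: parcs_mk_symmetric)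
    then obtain p where "prime_elem p" "quintessential g I p k" "quintessential g I p l" "k \<in> I" "l \<in> I"
      by (auto simp: quintessential_graph_def)
    then show ?case
      using quintessential_same_prime_imp_count_eq[OF assms(2-5)] step.IH by metis
  qed simp
qed

text \<open>Equal multiplicities make \<open>F\<close> a scalar multiple of \<open>f ^ a\<close>.
  Image-primitivity of \<open>f ^ a\<close> puts the scalar into \<open>D\<close>, and that of
  \<open>f ^ n\<close> makes it a unit.\<close>

lemma connected_imp_divisor_of_power:
  assumes "Digraph_Component.connected (quintessential_graph g I)" and FH: "F * H = f ^ n"
  obtains a u where "u dvd 1" and "F = int_valued_const u * f ^ a"
proof -
  obtain c M where cM: "c \<noteq> 0" "set_mset M \<subseteq> I"
    "poly_of_int_valued F = smult c (\<Prod>i\<in>#M. fract_poly (g i))"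
    by (rule divisor_of_power_representation[OF FH])
  obtain i where i: "i \<in> I" using I_nonempty by blast
  define a where "a = count M i"
  have "M = repeat_mset a (mset_set I)"
  proof (rule multiset_eqI)
    fix k
    show "count M k = count (repeat_mset a (mset_set I)) k"
    proof (cases "k \<in> I")
      case True
      then show ?thesis
        using connected_imp_count_eq[OF assms cM True i] finite_I by (simp add: a_def)
    next
      case False
      then have "count M k = 0" using cM(2) by (meson count_inI subsetD)
      then show ?thesis using False by simp
    qed
  qed
  moreover have "to_fract N ^ a * inverse (to_fract N) ^ a = 1"
    using prod_subset_T_nonzero[of T] by (simp del: prod_zero_iff flip: power_mult_distrib)
  ultimately have "poly_of_int_valued F =
      smult (c * to_fract N ^ a) (smult (inverse (to_fract N) ^ a)
        (\<Prod>i\<in>#repeat_mset a (mset_set I). fract_poly (g i)))"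
    unfolding cM(3) smult_smult mult.assoc by simp
  also have "\<dots> = smult (c * to_fract N ^ a) (poly_of_int_valued (f ^ a))"
    unfolding fract_poly_prod_g_power[symmetric] poly_of_int_valued_power rep_f ..
  finally obtain u where u: "F = int_valued_const u * f ^ a"
    by (rule image_primitive_smult[OF image_primitive_power[OF pid image_primitive_f]])
  then have "int_valued_const u dvd F" by simp
  moreover have "F dvd f ^ n" using FH by (metis dvd_triv_left)
  ultimately have "u dvd 1"
    using image_primitive_int_valued_const_dvd[OF image_primitive_power[OF pid image_primitive_f]] dvd_trans
    by blast
  then show thesis using u by (rule that)
qed

lemma degree_unit_mult_power_f:
  assumes "u dvd 1"
  shows "degree (poly_of_int_valued (int_valued_const u * f ^ a)) = a * degree (poly_of_int_valued f)"
proof -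
  have u: "int_valued_const u dvd 1" using assms by (rule int_valued_const_dvd_1)
  then have "int_valued_const u \<noteq> 0" by auto
  then have "int_valued_const u * f ^ a \<noteq> 0" using f_nonzero by simp
  then show ?thesis
    by (simp add: int_valued_degree_mult int_valued_degree_power int_valued_dvd_1_imp_degree_eq_0[OF u])
qed

text \<open>Both factors are units times powers of \<open>f\<close>, and by degrees the exponents
  add up to 1.\<close>

lemma connected_imp_irreducible:
  assumes conn: "Digraph_Component.connected (quintessential_graph g I)"
  shows "irreducible f"
proof (rule irreducibleI)
  fix F H assume FH: "f = F * H"
  then have FH1: "F * H = f ^ 1" by (simp only: power_one_right)
  then have HF1: "H * F = f ^ 1" by (simp only: mult.commute)
  obtain u a where F: "u dvd 1" "F = int_valued_const u * f ^ a"
    by (rule connected_imp_divisor_of_power[OF conn FH1])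
  obtain v b where H: "v dvd 1" "H = int_valued_const v * f ^ b"
    by (rule connected_imp_divisor_of_power[OF conn HF1])
  have "degree (poly_of_int_valued f) = (a + b) * degree (poly_of_int_valued f)"
    using int_valued_degree_mult[of F H] f_nonzero degree_unit_mult_power_f[OF F(1), of a]
      degree_unit_mult_power_f[OF H(1), of b]
    unfolding FH[symmetric] F(2)[symmetric] H(2)[symmetric] by (simp only: add_mult_distrib) blast
  then have "a + b = 1" using degree_f by simp
  then have "a = 0 \<or> b = 0" by auto
  then show "F dvd 1 \<or> H dvd 1"
    using int_valued_const_dvd_1[OF F(1)] int_valued_const_dvd_1[OF H(1)] F(2) H(2)
    by (metis mult.right_neutral power_0)
qed (use f_nonzero f_not_unit in auto)

lemma connected_imp_absolutely_irreducible:
  assumes conn: "Digraph_Component.connected (quintessential_graph g I)"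
  shows "absolutely_irreducible f"
  unfolding absolutely_irreducible_def
proof (intro conjI allI impI)
  show "irreducible f" by (rule connected_imp_irreducible[OF conn])
  fix n A assume A: "irreducible_factorization A (f ^ n)"
  have assoc: "associated F f" if "F \<in># A" for F
  proof -
    have F: "irreducible F" using that A unfolding irreducible_factorization_def by blast
    have "F * prod_mset (A - {#F#}) = f ^ n"
      using that A unfolding irreducible_factorization_def by (metis insert_DiffM prod_mset.add_mset)
    then obtain u a where u: "u dvd 1" "F = int_valued_const u * f ^ a"
      using connected_imp_divisor_of_power[OF conn] by metis
    let ?u = "int_valued_const u"
    have uu: "?u dvd 1" using u(1) by (rule int_valued_const_dvd_1)
    have "a \<noteq> 0" using u(2) uu F irreducible_not_unit by (metis mult.right_neutral power_0)
    then obtain b where b: "a = Suc b" using not0_implies_Suc by blast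
    then have "F = f * (?u * f ^ b)" using u(2) by (simp add: mult_ac)
    \<comment> \<open>As \<open>F\<close> is irreducible and \<open>f\<close> is no unit, the
      cofactor is a unit; its degree 0 then forces \<open>b = 0\<close>.\<close>
    then have "?u * f ^ b dvd 1" using F f_not_unit irreducibleD by blast
    then have "b * degree (poly_of_int_valued f) = 0"
      using degree_unit_mult_power_f[OF u(1)] int_valued_dvd_1_imp_degree_eq_0 by metis
    then have "F = ?u * f" using u(2) b degree_f by simp
    then show ?thesis using uu unfolding associated_def by blast
  qed
  have "n * degree (poly_of_int_valued f) = size A * degree (poly_of_int_valued f)"
    using degree_prod_mset_associated[OF f_nonzero, of A] assoc A int_valued_degree_power[of f n]
    unfolding irreducible_factorization_def by simp
  then have "size A = n" using degree_f by simp
  then show "essentially_same A (replicate_mset n f)"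
    unfolding essentially_same_replicate_mset_iff using assoc by blast
qed

section \<open>Separated index sets, and the case of a disconnected graph\<close>

text \<open>The primes in \<open>S\<close> now occur squared in the denominator. The second
  \<open>p\<close> needed in the numerator comes from the failure of quintessence on
  \<open>X\<close>.\<close>

lemma multiple_of_f_integer_valued:
  assumes X: "X \<subseteq> I" and S: "S \<subseteq> T"
    and not_quint: "\<And>p i. p \<in> S \<Longrightarrow> i \<in> X \<Longrightarrow> \<not> quintessential g I p i"
  obtains F where "poly_of_int_valued F =
    poly_of_int_valued f * smult (inverse (to_fract (\<Prod>p\<in>S. p))) (fract_poly (\<Prod>i\<in>I - X. g i))"
proof -
  let ?D = "\<Prod>p\<in>S. p"
  let ?q = "poly_of_int_valued f * smult (inverse (to_fract ?D)) (fract_poly (\<Prod>i\<in>I - X. g i))"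
  have "\<exists>b. poly ?q (to_fract w) = to_fract b" for w
  proof -
    let ?y = "(\<Prod>i\<in>I. poly (g i) w) * (\<Prod>i\<in>I - X. poly (g i) w)"
    \<comment> \<open>The exponent of \<open>p\<close> in \<open>N * ?D\<close>: primes in
      \<open>S\<close> occur in both factors.\<close>
    let ?e = "\<lambda>p. if p \<in> S then 2 else 1 :: nat"
    have "N * ?D = (\<Prod>p\<in>T. p) * (\<Prod>p\<in>T. if p \<in> S then p else 1)"
      using S finite_T by (simp add: prod.inter_restrict[symmetric] Int_absorb1)
    also have "\<dots> = (\<Prod>p\<in>T. p ^ ?e p)"
      unfolding prod.distrib[symmetric] by (intro prod.cong) (auto simp: power2_eq_square)
    also have "\<dots> dvd ?y"
    proof (rule prod_prime_elem_powers_dvd[OF finite_T prime_T not_associated_T])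
      fix p assume pT: "p \<in> T"
      have p: "prime_elem p" using pT by (rule prime_T)
      have "p dvd N" using dvd_prodI[OF finite_T pT, of "\<lambda>p. p"] by simp
      then have pI: "p dvd (\<Prod>i\<in>I. poly (g i) w)" unfolding N_mult_int_value[symmetric] by simp
      show "p ^ ?e p dvd ?y"
      proof (cases "p \<in> S")
        case False
        then show ?thesis using pI by simp
      next
        case True
        have "p ^ 2 dvd ?y"
        \<comment> \<open>One \<open>p\<close> always divides the product over \<open>I\<close>. The
          second comes from the extra product over \<open>I - X\<close> or, failing that, again from
          the product over \<open>I\<close>.\<close>
        proof (cases "p dvd (\<Prod>i\<in>I - X. poly (g i) w)")
          case True
          then show ?thesis using pI by (simp add: power2_eq_square mult_dvd_mono)
        next
          case False
          obtain i where i: "i \<in> I" "p dvd poly (g i) w" by (rule prime_elem_dvd_prodE[OF p pI])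
          have "i \<in> X"
          proof (rule ccontr)
            assume "i \<notin> X"
            then have "poly (g i) w dvd (\<Prod>i\<in>I - X. poly (g i) w)"
              using i(1) finite_I by (intro dvd_prodI) auto
            then show False using i(2) False dvd_trans by blast
          qed
          \<comment> \<open>Otherwise \<open>w\<close> would witness that \<open>i\<close> is
            quintessential for \<open>p\<close>.\<close>
          then have "p ^ 2 dvd poly (g i) w \<or> (\<exists>j\<in>I - {i}. p dvd poly (g j) w)"
            using not_quint[OF True] \<open>p dvd N\<close> i(2) unfolding quintessential_iff[OF p] by blast
          then have "p ^ 2 dvd poly (g i) w * (\<Prod>j\<in>I - {i}. poly (g j) w)"
          proof
            assume "\<exists>j\<in>I - {i}. p dvd poly (g j) w"
            then have "p dvd (\<Prod>j\<in>I - {i}. poly (g j) w)"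
              using finite_I dvd_prodI[of "I - {i}" _ "\<lambda>j. poly (g j) w"] dvd_trans by blast
            then show ?thesis unfolding power2_eq_square using i(2) by (rule mult_dvd_mono[rotated])
          qed simp
          then show ?thesis using prod.remove[OF finite_I i(1), of "\<lambda>i. poly (g i) w"] by simp
        qed
        then show ?thesis using True by simp
      qed
    qed
    finally obtain b where b: "?y = N * ?D * b" by (rule dvdE)
    have nz: "to_fract N \<noteq> 0" "to_fract ?D \<noteq> 0"
      using prod_subset_T_nonzero[of T] prod_subset_T_nonzero[OF S] by (simp_all del: prod_zero_iff)
    have "poly ?q (to_fract w) = to_fract ?y / (to_fract N * to_fract ?D)"
      unfolding rep_f by (simp add: poly_prod field_simps)
    also have "\<dots> = to_fract b" unfolding b using nz by simp
    finally show ?thesis by blast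
  qed
  then have "?q \<in> {f. \<forall>a. poly f (to_fract a) \<in> range to_fract}" by blast
  then show thesis using that[of "Int_valued ?q"] by (simp add: Int_valued_inverse)
qed

text \<open>\<open>F\<close> and \<open>H\<close> each contain a full copy of \<open>f\<close>, and
  their extra parts multiply to a third one. If \<open>f\<close> were absolutely irreducible,
  \<open>F\<close> would be a product of associates of \<open>f\<close>, so its degree would be a
  multiple of that of \<open>f\<close>.\<close>

lemma separated_imp_not_absolutely_irreducible:
  assumes XY: "X \<union> Y = I" "X \<inter> Y = {}" "X \<noteq> {}" "Y \<noteq> {}"
    and sep: "\<And>p i j. prime_elem p \<Longrightarrow> i \<in> X \<Longrightarrow> j \<in> Y \<Longrightarrow>
      quintessential g I p i \<Longrightarrow> \<not> quintessential g I p j"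
  shows "\<not> absolutely_irreducible f"
proof
  assume abs: "absolutely_irreducible f"
  \<comment> \<open>\<open>U\<close> also takes the primes for which no index is quintessential. A
    prime in \<open>T - U\<close> has a quintessential index in \<open>Y\<close>, hence by
    separation none in \<open>X\<close>.\<close>
  define U where "U = {p \<in> T. \<forall>j\<in>Y. \<not> quintessential g I p j}"
  let ?gX = "fract_poly (\<Prod>i\<in>X. g i)" and ?gY = "fract_poly (\<Prod>i\<in>Y. g i)"
  let ?dU = "\<Prod>p\<in>U. p" and ?dV = "\<Prod>p\<in>T - U. p"
  let ?deg = "\<lambda>F. degree (poly_of_int_valued F)"
  have IX: "I - X = Y" and IY: "I - Y = X" using XY by auto
  have fin: "finite X" "finite Y" using finite_I XY(1) by auto
  have UT: "U \<subseteq> T" unfolding U_def by auto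
  have nz: "to_fract ?dU \<noteq> 0" "to_fract ?dV \<noteq> 0"
    using prod_subset_T_nonzero[OF UT] prod_subset_T_nonzero[of "T - U"] by (simp_all del: prod_zero_iff)
  have "\<not> quintessential g I p i" if "p \<in> T - U" "i \<in> X" for p i
    using that sep[OF prime_T] unfolding U_def by blast
  then obtain F where F: "poly_of_int_valued F = poly_of_int_valued f * smult (inverse (to_fract ?dV)) ?gY"
    using multiple_of_f_integer_valued[of X "T - U"] XY(1) unfolding IX by blast
  have "\<not> quintessential g I p i" if "p \<in> U" "i \<in> Y" for p i
    using that unfolding U_def by blast
  then obtain H where H: "poly_of_int_valued H = poly_of_int_valued f * smult (inverse (to_fract ?dU)) ?gX"
    using multiple_of_f_integer_valued[of Y U] XY(1) UT unfolding IY by blast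
  have prod_I: "fract_poly (\<Prod>i\<in>I. g i) = ?gX * ?gY"
    using prod.union_disjoint[OF fin XY(2), of g] unfolding XY(1) by simp
  have prod_T: "to_fract N = to_fract ?dU * to_fract ?dV"
    using prod.subset_diff[OF UT finite_T, of "\<lambda>p. p"] by (simp add: mult.commute)
  have f_eq: "smult (inverse (to_fract ?dV)) ?gY * smult (inverse (to_fract ?dU)) ?gX = poly_of_int_valued f"
    unfolding rep_f prod_I prod_T using nz by (simp add: mult_ac)
  have "poly_of_int_valued (F * H) = poly_of_int_valued f * poly_of_int_valued f *
      (smult (inverse (to_fract ?dV)) ?gY * smult (inverse (to_fract ?dU)) ?gX)"
    unfolding poly_of_int_valued_mult F H by (simp only: mult_ac)
  then have "poly_of_int_valued (F * H) = poly_of_int_valued (f ^ 3)"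
    unfolding f_eq poly_of_int_valued_power by (simp only: power3_eq_cube)
  then have FH: "F * H = f ^ 3" by (simp only: poly_of_int_valued_inject)
  then have FH_dvd: "F dvd f ^ 3" "H dvd f ^ 3" by (metis dvd_triv_left, metis dvd_triv_right)
  have FH_nz: "F \<noteq> 0" "H \<noteq> 0" using FH f_nonzero by auto
  have g_nz: "g i \<noteq> 0" if "i \<in> I" for i using primitive_imp_nonzero[OF primitive_g[OF that]] .
  have deg_pos: "degree (fract_poly (\<Prod>i\<in>Z. g i)) > 0" if "Z \<subseteq> I" "Z \<noteq> {}" for Z
  proof -
    obtain i where i: "i \<in> Z" using \<open>Z \<noteq> {}\<close> by blast
    have fin: "finite Z" using finite_I that(1) by (rule rev_finite_subset)
    have "degree (g i) \<le> degree (\<Prod>i\<in>Z. g i)"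
      using g_nz that(1) by (intro dvd_imp_degree_le dvd_prodI[OF fin i]) (auto simp: fin)
    moreover have "degree (g i) > 0"
      using primitive_irreducible_degree primitive_g irreducible_g i that(1) by blast
    ultimately show ?thesis by simp
  qed
  have pos: "degree ?gX > 0" "degree ?gY > 0" using deg_pos[of X] deg_pos[of Y] XY by auto
  then have g_prod_nz: "?gX \<noteq> 0" "?gY \<noteq> 0" by (metis degree_0 less_irrefl)+
  have deg_f: "?deg f = degree ?gX + degree ?gY"
    unfolding rep_f prod_I prod_T using nz by (simp add: degree_mult_eq[OF g_prod_nz])
  have deg_F: "?deg F = ?deg f + degree ?gY"
    unfolding F using nz(2) g_prod_nz(2) f_nonzero by (subst degree_mult_eq) (auto simp: poly_of_int_valued_eq_0_iff)
  have deg_H: "?deg H = ?deg f + degree ?gX"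
    unfolding H using nz(1) g_prod_nz(1) f_nonzero by (subst degree_mult_eq) (auto simp: poly_of_int_valued_eq_0_iff)
  \<comment> \<open>As \<open>f ^ 3\<close> is image-primitive, only units occur as constant
    divisors of \<open>F\<close> and \<open>H\<close>; this is what the existence of irreducible
    factorizations requires.\<close>
  have const: "c dvd 1" if "int_valued_const c dvd E" "E dvd f ^ 3" for c E
    using that image_primitive_int_valued_const_dvd[OF image_primitive_power[OF pid image_primitive_f]]
      dvd_trans by blast
  obtain A where A: "irreducible_factorization A F"
    by (rule irreducible_factorization_exists[of F]) (use const FH_dvd deg_F pos in auto)
  obtain B where B: "irreducible_factorization B H"
    by (rule irreducible_factorization_exists[of H]) (use const FH_dvd deg_H pos in auto)
  have "irreducible_factorization (A + B) (f ^ 3)"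
    using A B FH unfolding irreducible_factorization_def by auto
  then have "essentially_same (A + B) (replicate_mset 3 f)"
    using abs unfolding absolutely_irreducible_def by blast
  then have "associated a f" if "a \<in># A" for a
    using that unfolding essentially_same_replicate_mset_iff by auto
  then have "?deg F = size A * ?deg f"
    using degree_prod_mset_associated[OF f_nonzero, of A] A unfolding irreducible_factorization_def by simp
  \<comment> \<open>The degree of \<open>F\<close> exceeds that of \<open>f\<close> by the degree of
    \<open>?gY\<close>, which is positive and smaller than the degree of \<open>f\<close>.\<close>
  then have "1 * ?deg f < size A * ?deg f" "size A * ?deg f < 2 * ?deg f"
    using deg_F deg_f pos by linarith+
  then have "1 < size A" "size A < 2" by (simp_all only: mult_less_cancel2)
  then show False by simp
qed

text \<open>If \<open>v\<close> is not reachable from \<open>u\<close>, the set of indices reachable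
  from \<open>u\<close> and its complement form a separation.\<close>

lemma absolutely_irreducible_imp_connected:
  assumes "absolutely_irreducible f"
  shows "Digraph_Component.connected (quintessential_graph g I)"
proof (rule ccontr)
  let ?Q = "quintessential_graph g I"
  let ?G = "mk_symmetric (with_proj ?Q)"
  interpret Q: pair_graph ?Q by (rule pair_graph_quintessential_graph[OF finite_I])
  interpret G: pair_wf_digraph ?G by (rule Q.wellformed_mk_symmetric)
  have verts: "pverts ?G = I" by (simp add: quintessential_graph_def)
  assume "\<not> Digraph_Component.connected ?Q"
  then obtain u v where uv: "u \<in> I" "v \<in> I" "\<not> u \<rightarrow>\<^sup>*\<^bsub>with_proj ?G\<^esub> v"
    using I_nonempty verts unfolding Digraph_Component.connected_def strongly_connected_def by auto
  define X where "X = {j \<in> I. u \<rightarrow>\<^sup>*\<^bsub>with_proj ?G\<^esub> j}"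
  have "\<not> absolutely_irreducible f"
  proof (rule separated_imp_not_absolutely_irreducible[of X "I - X"])
    show "X \<noteq> {}" using uv(1) verts unfolding X_def by auto
    show "I - X \<noteq> {}" using uv(2,3) unfolding X_def by auto
    fix p i j
    assume p: "prime_elem p" and i: "i \<in> X" and j: "j \<in> I - X" and qi: "quintessential g I p i"
    show "\<not> quintessential g I p j"
    proof
      assume "quintessential g I p j"
      then have "(i, j) \<in> parcs ?Q"
        using p qi i j unfolding quintessential_graph_def X_def by auto
      then have "i \<rightarrow>\<^bsub>with_proj ?G\<^esub> j" by (auto simp: parcs_mk_symmetric)
      then have "u \<rightarrow>\<^sup>*\<^bsub>with_proj ?G\<^esub> j" using i unfolding X_def by (auto intro: G.reachable_adj_trans)
      then show False using j unfolding X_def by blast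
    qed
  qed (auto simp: X_def)
  then show False using assms by blast
qed

end

theorem theorem3:
  fixes f :: "'a::idom int_valued_poly"
    and g :: "'i \<Rightarrow> 'a poly" and I :: "'i set" and T :: "'a set"
  assumes "principal_ideal_domain TYPE('a)"
    and "degree (poly_of_int_valued f) > 0"
    and "image_primitive f"
    and "finite I" and "I \<noteq> {}"
    and "\<And>i. i \<in> I \<Longrightarrow> primitive (g i)"
    and "\<And>i. i \<in> I \<Longrightarrow> irreducible (g i)"
    and "finite T"
    and "\<And>p. p \<in> T \<Longrightarrow> prime_elem p"
    and "\<And>p q. p \<in> T \<Longrightarrow> q \<in> T \<Longrightarrow> p \<noteq> q \<Longrightarrow> \<not> associated p q"
    and "poly_of_int_valued f = smult (inverse (to_fract (\<Prod>p\<in>T. p))) (fract_poly (\<Prod>i\<in>I. g i))"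
  shows "absolutely_irreducible f \<longleftrightarrow> Digraph_Component.connected (quintessential_graph g I)"
proof -
  interpret image_primitive_standard_form f g I T
    by unfold_locales (fact assms)+
  show ?thesis
    using connected_imp_absolutely_irreducible absolutely_irreducible_imp_connected by blast
qed

end
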